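(* Let $F$ be a field, let $f:\mathbb{N}\to\mathbb{N}$ be increasing and submultiplicative with $f(Cn)\ge nf(n)$ for some $C>0$ and all $n\in\mathbb{N}$, and let $d=f(1)$. Let $A=F\langle x_1,\dots,x_d\rangle$, and let $C(2^n)\subseteq W(2^n)\subseteq M(2^n)$ ($n\ge 0$) be sets of monomials with $$W(1)=\{x_1,\dots,x_d\},\qquad W(2^{n+1})=C(2^n)W(2^n),\qquad |C(2^n)|=\left\lceil \tfrac{f(2^{n+1})}{f(2^n)}\right\rceil .$$ Let $\mu:\mathbb{N}\cup\{0\}\to\mathbb{N}$ be an increasing function such that $f(2^{\mu(n)+1})\ge |W(2^n)|\cdot f(2^{\mu(n)})$ for all $n\in\mathbb{N}\cup\{0\}$, and suppose that for every $n\in\mathbb{N}$ the set $C(2^{\mu(n)})$ was chosen so that $\Pi^{\mu(n)}_{n}\big(C(2^{\mu(n)})\big)=W(2^n)$. Let $W=\bigcup_{n\geq 0}W(2^n)$ and let $I$ be the ideal of $A$ generated by all monomials which are not subwords of any monomial of $W$. Then the algebra $B=A/I$ is prime.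
   Context: $\mathbb{N}=\{1,2,3,\dots\}$. Increasing means $f(n)<f(n+1)$ for all $n$ (and similarly for $\mu$); submultiplicative means $f(m+n)\le f(m)f(n)$ for all $m,n$. $C$ may be taken to be a positive integer. $A$ is the free associative unital algebra; $M(n)$ is the set of monomials (words) of degree $n$ in $x_1,\dots,x_d$, and $|w|$ denotes the length of a word $w$. For sets of words $S,T$, $ST=\{st:s\in S,t\in T\}$. For $m'\ge m\ge 0$, the map $\Pi^{m'}_{m}:M(2^{m'})\to M(2^m)$ sends a word of length $2^{m'}$ to its suffix of length $2^m$, i.e. $\Pi^{m'}_m(uw)=w$ where $|u|=2^{m'}-2^m$, $|w|=2^m$; for a set $S$, $\Pi^{m'}_m(S)=\{\Pi^{m'}_m(s):s\in S\}$. *)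

theory Defs
  imports Complex_Main "HOL-Algebra.QuotRing" "HOL-Algebra.Ideal_Product" "HOL-Library.Sublist"
begin

text \<open>
  Monomials are words, i.e. lists, over a set of letters. An element of the free associative unital
  algebra on \<open>V\<close> is the family of its coefficients: a finitely supported function from the
  words over \<open>V\<close> to \<open>F\<close>, extended by zero to all lists.
\<close>

definition factorizations :: "'x list \<Rightarrow> ('x list \<times> 'x list) set" where
  "factorizations w = {(u, v). u @ v = w}"

definition free_algebra :: "('a, 'm) ring_scheme \<Rightarrow> 'x set \<Rightarrow> ('x list \<Rightarrow> 'a) ring" where
  "free_algebra F V = \<lparr>
     carrier = {p. (\<forall>w. p w \<in> carrier F) \<and> (\<forall>w. w \<notin> lists V \<longrightarrow> p w = \<zero>\<^bsub>F\<^esub>)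
                   \<and> finite {w. p w \<noteq> \<zero>\<^bsub>F\<^esub>}},
     mult = (\<lambda>p q w. \<Oplus>\<^bsub>F\<^esub>uv\<in>factorizations w. p (fst uv) \<otimes>\<^bsub>F\<^esub> q (snd uv)),
     one = (\<lambda>w. if w = [] then \<one>\<^bsub>F\<^esub> else \<zero>\<^bsub>F\<^esub>),
     zero = (\<lambda>w. \<zero>\<^bsub>F\<^esub>),
     add = (\<lambda>p q w. p w \<oplus>\<^bsub>F\<^esub> q w)\<rparr>"

definition monomial :: "('a, 'm) ring_scheme \<Rightarrow> 'x list \<Rightarrow> ('x list \<Rightarrow> 'a)" where
  "monomial F u = (\<lambda>w. if w = u then \<one>\<^bsub>F\<^esub> else \<zero>\<^bsub>F\<^esub>)"

text \<open>
  Primeness of a not necessarily commutative ring; the library's \<open>primeideal\<close> presupposes a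
  commutative ring, whereas \<open>ideal\<close> is two-sided. In a quotient of \<open>free_algebra F V\<close>
  the scalars are multiples of the unit, so two-sided ring ideals and algebra ideals coincide.
\<close>

locale prime_ring = ring +
  assumes nontrivial: "carrier R \<noteq> {\<zero>}"
    and prime: "\<lbrakk>ideal I R; ideal J R; I \<cdot> J = {\<zero>}\<rbrakk> \<Longrightarrow> I = {\<zero>} \<or> J = {\<zero>}"

definition words :: "nat \<Rightarrow> nat \<Rightarrow> nat list set" where
  "words d k = {w \<in> lists {1..d}. length w = k}"

definition word_prod :: "'x list set \<Rightarrow> 'x list set \<Rightarrow> 'x list set"  (infixl "\<bullet>\<^sub>w" 70) where
  "S \<bullet>\<^sub>w T = {s @ t | s t. s \<in> S \<and> t \<in> T}"

text \<open>The map \<open>\<Pi>\<close> from words of length \<open>2 ^ m'\<close> to their suffixes of length \<open>2 ^ m\<close>,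
  used only for \<open>m \<le> m'\<close>.\<close>

definition suffix_proj :: "nat \<Rightarrow> nat \<Rightarrow> 'x list \<Rightarrow> 'x list" where
  "suffix_proj m' m w = drop (2 ^ m' - 2 ^ m) w"


lemma factorizations_eq: "factorizations w = (\<lambda>i. (take i w, drop i w)) ` {..length w}"
proof
  show "factorizations w \<subseteq> (\<lambda>i. (take i w, drop i w)) ` {..length w}"
  proof
    fix x assume "x \<in> factorizations w"
    then obtain u v where "x = (u, v)" "w = u @ v" by (auto simp: factorizations_def)
    then show "x \<in> (\<lambda>i. (take i w, drop i w)) ` {..length w}"
      by (intro image_eqI[of _ _ "length u"]) auto
  qed
qed (auto simp: factorizations_def)

lemma finite_factorizations [simp]: "finite (factorizations w)"
  by (simp add: factorizations_eq)

lemma factorizations_Nil [simp]: "factorizations [] = {([], [])}"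
  by (auto simp: factorizations_def)

lemma Nil_in_factorizations: "([], w) \<in> factorizations w" "(w, []) \<in> factorizations w"
  by (auto simp: factorizations_def)

lemma (in abelian_monoid) finsum_Sigma:
  assumes "finite A" "\<And>a. a \<in> A \<Longrightarrow> finite (B a)"
    "\<And>a b. a \<in> A \<Longrightarrow> b \<in> B a \<Longrightarrow> f a b \<in> carrier G"
  shows "(\<Oplus>a\<in>A. \<Oplus>b\<in>B a. f a b) = (\<Oplus>ab\<in>Sigma A B. f (fst ab) (snd ab))"
  using assms
proof (induction A rule: finite_induct)
  case (insert x A)
  have S: "Sigma (insert x A) B = Pair x ` B x \<union> Sigma A B" by auto
  have "(\<Oplus>ab\<in>Pair x ` B x. f (fst ab) (snd ab)) = (\<Oplus>b\<in>B x. f x b)"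
    using insert.prems by (subst finsum_reindex) (auto simp: inj_on_def)
  moreover have "(\<Oplus>ab\<in>Sigma (insert x A) B. f (fst ab) (snd ab)) =
      (\<Oplus>ab\<in>Pair x ` B x. f (fst ab) (snd ab)) \<oplus> (\<Oplus>ab\<in>Sigma A B. f (fst ab) (snd ab))"
    unfolding S using insert by (intro finsum_Un_disjoint) auto
  ultimately show ?case using insert by (simp add: Pi_def)
qed simp

lemma (in ring) free_algebra_mult_assoc:
  fixes p q r :: "'x list \<Rightarrow> 'a"
  assumes "\<And>w. p w \<in> carrier R" "\<And>w. q w \<in> carrier R" "\<And>w. r w \<in> carrier R"
  shows "(\<Oplus>uv\<in>factorizations w. (\<Oplus>xy\<in>factorizations (fst uv). p (fst xy) \<otimes> q (snd xy)) \<otimes> r (snd uv))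
       = (\<Oplus>uv\<in>factorizations w. p (fst uv) \<otimes> (\<Oplus>xy\<in>factorizations (snd uv). q (fst xy) \<otimes> r (snd xy)))"
    (is "?L = ?R")
proof -
  define g where "g = (\<lambda>(t, u, v). p t \<otimes> (q u \<otimes> r v))"
  define T where "T = {(t, u, v). t @ u @ v = w}"
  have g: "g x \<in> carrier R" for x using assms by (auto simp: g_def split: prod.split)
  let ?hL = "\<lambda>ab::('x list \<times> 'x list) \<times> ('x list \<times> 'x list). (fst (snd ab), snd (snd ab), snd (fst ab))"
  let ?hR = "\<lambda>ab::('x list \<times> 'x list) \<times> ('x list \<times> 'x list). (fst (fst ab), fst (snd ab), snd (snd ab))"
  let ?SL = "Sigma (factorizations w) (\<lambda>uv. factorizations (fst uv))"
  let ?SR = "Sigma (factorizations w) (\<lambda>uv. factorizations (snd uv))"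
  have hL: "?hL ` ?SL = T" "inj_on ?hL ?SL"
    by (force simp: T_def factorizations_def image_iff) (auto simp: inj_on_def factorizations_def)
  have hR: "?hR ` ?SR = T" "inj_on ?hR ?SR"
    by (force simp: T_def factorizations_def image_iff) (auto simp: inj_on_def factorizations_def)
  have "?L = (\<Oplus>uv\<in>factorizations w. \<Oplus>xy\<in>factorizations (fst uv).
                p (fst xy) \<otimes> q (snd xy) \<otimes> r (snd uv))"
    using assms by (intro finsum_cong' refl) (auto simp: finsum_ldistr)
  also have "\<dots> = (\<Oplus>ab\<in>?SL. g (?hL ab))"
    using assms by (subst finsum_Sigma) (auto intro!: finsum_cong' simp: g_def m_assoc)
  also have "\<dots> = (\<Oplus>x\<in>T. g x)"
    using g hL finsum_reindex[of g ?hL ?SL] by (simp add: Pi_def)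
  also have "\<dots> = (\<Oplus>ab\<in>?SR. g (?hR ab))"
    using g hR finsum_reindex[of g ?hR ?SR] by (simp add: Pi_def)
  also have "\<dots> = (\<Oplus>uv\<in>factorizations w. \<Oplus>xy\<in>factorizations (snd uv).
                p (fst uv) \<otimes> (q (fst xy) \<otimes> r (snd xy)))"
    using assms by (subst finsum_Sigma) (auto intro!: finsum_cong' simp: g_def)
  also have "\<dots> = ?R"
    using assms by (intro finsum_cong' refl) (auto simp: finsum_rdistr)
  finally show ?thesis .
qed

lemma (in ring) free_algebra_mult_closed:
  assumes "p \<in> carrier (free_algebra R V)" "q \<in> carrier (free_algebra R V)"
  shows "p \<otimes>\<^bsub>free_algebra R V\<^esub> q \<in> carrier (free_algebra R V)"
proof -
  let ?s = "\<lambda>p. {w. p w \<noteq> \<zero>}"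
  let ?m = "\<lambda>w. \<Oplus>uv\<in>factorizations w. p (fst uv) \<otimes> q (snd uv)"
  have c: "p w \<in> carrier R" "q w \<in> carrier R" for w using assms by (auto simp: free_algebra_def)
  have V: "p w \<noteq> \<zero> \<Longrightarrow> w \<in> lists V" "q w \<noteq> \<zero> \<Longrightarrow> w \<in> lists V" for w
    using assms by (auto simp: free_algebra_def)
  have sub: "\<exists>u v. w = u @ v \<and> p u \<noteq> \<zero> \<and> q v \<noteq> \<zero>" if "?m w \<noteq> \<zero>" for w
  proof (rule ccontr)
    assume *: "\<not> ?thesis"
    have "?m w = (\<Oplus>uv\<in>factorizations w. \<zero>)"
      using c * by (intro finsum_cong' refl) (auto simp: factorizations_def, metis l_null r_null c)
    with that show False by simp
  qed
  have "?s ?m \<subseteq> (\<lambda>(u, v). u @ v) ` (?s p \<times> ?s q)"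
    using sub by fastforce
  moreover have "finite (?s p)" "finite (?s q)" using assms by (auto simp: free_algebra_def)
  ultimately have "finite (?s ?m)" by (meson finite_SigmaI finite_imageI finite_subset)
  moreover have "w \<in> lists V" if "?m w \<noteq> \<zero>" for w
    using sub[OF that] V by (metis append_in_lists_conv)
  moreover have "?m w \<in> carrier R" for w using c by auto
  ultimately show ?thesis unfolding free_algebra_def by auto
qed

lemma (in ring) free_algebra_ring:
  fixes V :: "'x set"
  shows "ring (free_algebra R V)" (is "ring ?A")
proof (rule ringI)
  have car: "p w \<in> carrier R" if "p \<in> carrier ?A" for p w
    using that by (simp add: free_algebra_def)
  have add: "p \<oplus>\<^bsub>?A\<^esub> q \<in> carrier ?A" if "p \<in> carrier ?A" "q \<in> carrier ?A" for p q
  proof -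
    have "{w. p w \<oplus> q w \<noteq> \<zero>} \<subseteq> {w. p w \<noteq> \<zero>} \<union> {w. q w \<noteq> \<zero>}" by auto
    then have "finite {w. p w \<oplus> q w \<noteq> \<zero>}"
      using that by (auto simp: free_algebra_def intro: finite_subset)
    then show ?thesis using that by (auto simp: free_algebra_def)
  qed
  show "abelian_group ?A"
  proof (rule abelian_groupI)
    show "p \<oplus>\<^bsub>?A\<^esub> q \<in> carrier ?A" if "p \<in> carrier ?A" "q \<in> carrier ?A" for p q
      by (rule add) fact+
    show "\<zero>\<^bsub>?A\<^esub> \<in> carrier ?A" by (simp add: free_algebra_def)
    fix p assume p: "p \<in> carrier ?A"
    let ?n = "\<lambda>w. \<ominus> p w"
    have "{w. ?n w \<noteq> \<zero>} \<subseteq> {w. p w \<noteq> \<zero>}" by auto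
    then have "?n \<in> carrier ?A"
      using p by (auto simp: free_algebra_def intro: finite_subset)
    moreover have "?n \<oplus>\<^bsub>?A\<^esub> p = \<zero>\<^bsub>?A\<^esub>"
      using p by (auto simp: free_algebra_def l_neg)
    ultimately show "\<exists>q\<in>carrier ?A. q \<oplus>\<^bsub>?A\<^esub> p = \<zero>\<^bsub>?A\<^esub>" by blast
  qed (auto simp: free_algebra_def a_ac)
  show "monoid ?A"
  proof (rule monoidI)
    show "p \<otimes>\<^bsub>?A\<^esub> q \<in> carrier ?A" if "p \<in> carrier ?A" "q \<in> carrier ?A" for p q
      using that by (rule free_algebra_mult_closed)
    show "\<one>\<^bsub>?A\<^esub> \<in> carrier ?A" by (auto simp: free_algebra_def)
    show "p \<otimes>\<^bsub>?A\<^esub> q \<otimes>\<^bsub>?A\<^esub> r = p \<otimes>\<^bsub>?A\<^esub> (q \<otimes>\<^bsub>?A\<^esub> r)"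
      if "p \<in> carrier ?A" "q \<in> carrier ?A" "r \<in> carrier ?A" for p q r
      using free_algebra_mult_assoc[of p q r] that by (auto simp: free_algebra_def)
    fix p assume p: "p \<in> carrier ?A"
    note c = car[OF p]
    have "(\<Oplus>uv\<in>factorizations w. (if fst uv = [] then \<one> else \<zero>) \<otimes> p (snd uv)) = p w" for w
    proof -
      have "(\<Oplus>uv\<in>factorizations w. (if fst uv = [] then \<one> else \<zero>) \<otimes> p (snd uv))
          = (\<Oplus>uv\<in>factorizations w. if ([], w) = uv then p (snd uv) else \<zero>)"
        using c by (intro finsum_cong' refl) (auto simp: factorizations_def)
      also have "\<dots> = p (snd ([] :: 'x list, w))"
        using c by (intro finsum_singleton[of "([], w)" _ "\<lambda>uv. p (snd uv)"])
          (simp_all add: Nil_in_factorizations)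
      finally show ?thesis by simp
    qed
    then show "\<one>\<^bsub>?A\<^esub> \<otimes>\<^bsub>?A\<^esub> p = p" by (simp add: free_algebra_def)
    have "(\<Oplus>uv\<in>factorizations w. p (fst uv) \<otimes> (if snd uv = [] then \<one> else \<zero>)) = p w" for w
    proof -
      have "(\<Oplus>uv\<in>factorizations w. p (fst uv) \<otimes> (if snd uv = [] then \<one> else \<zero>))
          = (\<Oplus>uv\<in>factorizations w. if (w, []) = uv then p (fst uv) else \<zero>)"
        using c by (intro finsum_cong' refl) (auto simp: factorizations_def)
      also have "\<dots> = p (fst (w, [] :: 'x list))"
        using c by (intro finsum_singleton[of "(w, [])" _ "\<lambda>uv. p (fst uv)"])
          (simp_all add: Nil_in_factorizations)
      finally show ?thesis by simp
    qed
    then show "p \<otimes>\<^bsub>?A\<^esub> \<one>\<^bsub>?A\<^esub> = p" by (simp add: free_algebra_def)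
  qed
  fix p q r assume pqr: "p \<in> carrier ?A" "q \<in> carrier ?A" "r \<in> carrier ?A"
  note c = car[OF pqr(1)] car[OF pqr(2)] car[OF pqr(3)]
  show "(p \<oplus>\<^bsub>?A\<^esub> q) \<otimes>\<^bsub>?A\<^esub> r = p \<otimes>\<^bsub>?A\<^esub> r \<oplus>\<^bsub>?A\<^esub> q \<otimes>\<^bsub>?A\<^esub> r"
    using c by (auto simp: free_algebra_def l_distr finsum_addf Pi_def)
  show "r \<otimes>\<^bsub>?A\<^esub> (p \<oplus>\<^bsub>?A\<^esub> q) = r \<otimes>\<^bsub>?A\<^esub> p \<oplus>\<^bsub>?A\<^esub> r \<otimes>\<^bsub>?A\<^esub> q"
    using c by (auto simp: free_algebra_def r_distr finsum_addf Pi_def)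
qed

lemma (in ring) monomial_closed: "u \<in> lists V \<Longrightarrow> monomial R u \<in> carrier (free_algebra R V)"
  by (auto simp: free_algebra_def monomial_def)

lemma (in ring) monomial_mult:
  "monomial R u \<otimes>\<^bsub>free_algebra R V\<^esub> monomial R v = monomial R (u @ v)"
proof
  fix w
  have "(\<Oplus>xy\<in>factorizations w. monomial R u (fst xy) \<otimes> monomial R v (snd xy))
      = (\<Oplus>xy\<in>factorizations w. if (u, v) = xy then \<one> else \<zero>)"
    by (intro finsum_cong' refl) (auto simp: monomial_def)
  also have "\<dots> = monomial R (u @ v) w"
  proof (cases "w = u @ v")
    case True
    then have "(\<Oplus>xy\<in>factorizations w. if (u, v) = xy then \<one> else \<zero>) = (\<lambda>_. \<one>) (u, v)"
      using finite_factorizations[of w] by (intro finsum_singleton) (auto simp: factorizations_def)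
    with True show ?thesis by (simp add: monomial_def)
  next
    case False
    then have "(\<Oplus>xy\<in>factorizations w. if (u, v) = xy then \<one> else \<zero>) = (\<Oplus>xy\<in>factorizations w. \<zero>)"
      by (intro finsum_cong' refl) (auto simp: factorizations_def)
    with False show ?thesis by (simp add: monomial_def)
  qed
  finally show "(monomial R u \<otimes>\<^bsub>free_algebra R V\<^esub> monomial R v) w = monomial R (u @ v) w"
    by (simp add: free_algebra_def)
qed

end

theory Submission
  imports Defs
begin

text \<open>
  The ideal generated by the words outside a factor-closed set \<open>G\<close> consists of the polynomials
  supported outside \<open>G\<close>. If any two words \<open>u, v\<close> of \<open>G\<close> can be joined by some \<open>w\<close> to
  \<open>u @ w @ v\<close> in \<open>G\<close>, then for \<open>p, q\<close> outside the ideal take \<open>u, v\<close> to be the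
  longest words of \<open>G\<close> in their supports: comparing lengths, the coefficient of
  \<open>u @ w @ v\<close> in \<open>p w q\<close> is the product of those of \<open>u\<close> and \<open>v\<close>, so the quotient is
  prime. In the theorem, two subwords of words \<open>s, t\<close> of \<open>W(2\<^sup>n)\<close> are joined inside
  \<open>c c' \<in> C(2\<^bsup>\<mu>(n)\<^esup>) W(2\<^bsup>\<mu>(n)\<^esup>)\<close>, where \<open>c, c' \<in> C(2\<^bsup>\<mu>(n)\<^esup>)\<close> end in \<open>s\<close> and \<open>t\<close>.
\<close>

section \<open>Coefficients of products in the free algebra\<close>

lemma free_algebraD:
  assumes "p \<in> carrier (free_algebra R V)"
  shows "p w \<in> carrier R" "w \<notin> lists V \<Longrightarrow> p w = \<zero>\<^bsub>R\<^esub>" "finite {w. p w \<noteq> \<zero>\<^bsub>R\<^esub>}"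
  using assms by (auto simp: free_algebra_def)

lemma (in ring) free_algebra_mult_support:
  assumes "p \<in> carrier (free_algebra R V)" "q \<in> carrier (free_algebra R V)"
    and "(p \<otimes>\<^bsub>free_algebra R V\<^esub> q) w \<noteq> \<zero>"
  obtains u v where "w = u @ v" "p u \<noteq> \<zero>" "q v \<noteq> \<zero>"
proof (rule ccontr)
  assume "\<not> thesis"
  with that have none: "w = u @ v \<Longrightarrow> p u \<noteq> \<zero> \<Longrightarrow> q v \<noteq> \<zero> \<Longrightarrow> False" for u v by blast
  have *: "p (fst uv) = \<zero> \<or> q (snd uv) = \<zero>" if "uv \<in> factorizations w" for uv
    using that none[of "fst uv" "snd uv"] by (fastforce simp: factorizations_def)
  note c = free_algebraD(1)[OF assms(1)] free_algebraD(1)[OF assms(2)]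
  have "(\<Oplus>uv\<in>factorizations w. p (fst uv) \<otimes> q (snd uv)) = (\<Oplus>uv\<in>factorizations w. \<zero>)"
    using * c by (intro finsum_cong' refl) (auto, metis l_null r_null)
  with assms(3) show False by (simp add: free_algebra_def)
qed

text \<open>The coefficient is a sum over all cuts of \<open>u @ v\<close>. A cut with both
  coefficients nonzero has first factor \<open>u\<close>, hence by cancellation second factor
  \<open>v\<close>, so at most one summand survives.\<close>

lemma (in ring) free_algebra_mult_unique_factorization:
  assumes "p \<in> carrier (free_algebra R V)" "q \<in> carrier (free_algebra R V)"
    and "\<And>x y. x @ y = u @ v \<Longrightarrow> p x \<noteq> \<zero> \<Longrightarrow> q y \<noteq> \<zero> \<Longrightarrow> x = u"
  shows "(p \<otimes>\<^bsub>free_algebra R V\<^esub> q) (u @ v) = p u \<otimes> q v"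
proof -
  note c = free_algebraD(1)[OF assms(1)] free_algebraD(1)[OF assms(2)]
  have mem: "(u, v) \<in> factorizations (u @ v)" by (simp add: factorizations_def)
  have "p (fst uv) \<otimes> q (snd uv) = (if (u, v) = uv then p (fst uv) \<otimes> q (snd uv) else \<zero>)"
    if "uv \<in> factorizations (u @ v)" for uv
  proof (cases "p (fst uv) = \<zero> \<or> q (snd uv) = \<zero>")
    case True
    then show ?thesis using c by auto
  next
    case False
    then have "fst uv = u"
      using that assms(3)[of "fst uv" "snd uv"] by (auto simp: factorizations_def)
    then show ?thesis using that by (auto simp: factorizations_def)
  qed
  then have "(\<Oplus>uv\<in>factorizations (u @ v). p (fst uv) \<otimes> q (snd uv))
      = (\<Oplus>uv\<in>factorizations (u @ v). if (u, v) = uv then p (fst uv) \<otimes> q (snd uv) else \<zero>)"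
    using c by (intro finsum_cong' refl) auto
  also have "\<dots> = p (fst (u, v)) \<otimes> q (snd (u, v))"
    using c by (intro finsum_singleton[of "(u, v)" _ "\<lambda>uv. p (fst uv) \<otimes> q (snd uv)"])
      (simp_all add: mem)
  finally show ?thesis by (simp add: free_algebra_def)
qed

section \<open>Ideals generated by monomials\<close>

lemma (in ring) ideal_supported_outside_factor_closed:
  assumes G: "\<And>u v. G v \<Longrightarrow> sublist u v \<Longrightarrow> G u"
  shows "ideal {p \<in> carrier (free_algebra R V). \<forall>w. G w \<longrightarrow> p w = \<zero>} (free_algebra R V)"
    (is "ideal ?J ?A")
proof (rule idealI)
  interpret A: ring ?A by (rule free_algebra_ring)
  show "ring ?A" by (rule free_algebra_ring)
  show "subgroup ?J (add_monoid ?A)"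
  proof (rule A.add.subgroupI)
    have "\<zero>\<^bsub>?A\<^esub> \<in> ?J" using A.zero_closed by (simp add: free_algebra_def)
    then show "?J \<noteq> {}" by blast
    fix p assume p: "p \<in> ?J"
    \<comment> \<open>The inverse in \<open>?A\<close> is known only through the ring axioms, not
      coefficientwise, so its coefficient at \<open>w\<close> is read off from \<open>p\<close> plus
      its inverse being zero.\<close>
    have "(\<ominus>\<^bsub>?A\<^esub> p) w = \<zero>" if "p w = \<zero>" for w
    proof -
      have "(p \<oplus>\<^bsub>?A\<^esub> (\<ominus>\<^bsub>?A\<^esub> p)) w = \<zero>"
        using p A.r_neg[of p] by (simp add: free_algebra_def)
      moreover have "(\<ominus>\<^bsub>?A\<^esub> p) w \<in> carrier R"
        using p A.a_inv_closed[of p] free_algebraD(1) by blast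
      ultimately show ?thesis using that by (simp add: free_algebra_def)
    qed
    then show "\<ominus>\<^bsub>?A\<^esub> p \<in> ?J"
      using p A.a_inv_closed[of p] by blast
  next
    fix p q assume pq: "p \<in> ?J" "q \<in> ?J"
    then have "p \<oplus>\<^bsub>?A\<^esub> q \<in> carrier ?A" by auto
    with pq show "p \<oplus>\<^bsub>?A\<^esub> q \<in> ?J" by (auto simp: free_algebra_def)
  qed auto
  fix p x assume p: "p \<in> ?J" and x: "x \<in> carrier ?A"
  have pA: "p \<in> carrier ?A" using p by blast
  \<comment> \<open>A nonzero coefficient would give a suffix of \<open>w\<close> in the support of
    \<open>p\<close>. That suffix is a factor of a word of \<open>G\<close>, so it lies in
    \<open>G\<close>, where \<open>p\<close> vanishes. The other side uses a prefix.\<close>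
  have "(x \<otimes>\<^bsub>?A\<^esub> p) w = \<zero>" if "G w" for w
  proof (rule ccontr)
    assume "(x \<otimes>\<^bsub>?A\<^esub> p) w \<noteq> \<zero>"
    then obtain u v where "w = u @ v" "p v \<noteq> \<zero>"
      using free_algebra_mult_support[OF x pA] by metis
    with p G[OF that, of v] show False by auto
  qed
  then show "x \<otimes>\<^bsub>?A\<^esub> p \<in> ?J" using x pA by simp
  have "(p \<otimes>\<^bsub>?A\<^esub> x) w = \<zero>" if "G w" for w
  proof (rule ccontr)
    assume "(p \<otimes>\<^bsub>?A\<^esub> x) w \<noteq> \<zero>"
    then obtain u v where "w = u @ v" "p u \<noteq> \<zero>"
      using free_algebra_mult_support[OF pA x] by metis
    with p G[OF that, of u] show False by auto
  qed
  then show "p \<otimes>\<^bsub>?A\<^esub> x \<in> ?J" using x pA by simp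
qed

text \<open>A polynomial is the finite sum of its terms, and each term is a scalar multiple of a
  monomial in \<open>I\<close>.\<close>

lemma (in ring) mem_ideal_if_support_monomials:
  fixes V :: "'x set"
  assumes I: "ideal I (free_algebra R V)"
    and p: "p \<in> carrier (free_algebra R V)"
    and supp: "\<And>w. p w \<noteq> \<zero> \<Longrightarrow> monomial R w \<in> I"
  shows "p \<in> I"
proof -
  let ?A = "free_algebra R V"
  interpret A: ring ?A by (rule free_algebra_ring)
  interpret I: ideal I ?A by (rule I)
  \<comment> \<open>Induction on a finite superset \<open>S\<close> of the support, so that after a
    term is removed only an inclusion has to be checked.\<close>
  have "p \<in> I"
    if "finite S" "p \<in> carrier ?A" "{w. p w \<noteq> \<zero>} \<subseteq> S" "\<And>w. p w \<noteq> \<zero> \<Longrightarrow> monomial R w \<in> I" for S p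
    using that
  proof (induction S arbitrary: p rule: finite_induct)
    case empty
    then have "p = \<zero>\<^bsub>?A\<^esub>" by (auto simp: free_algebra_def)
    then show ?case by simp
  next
    case (insert u S)
    note c = free_algebraD(1)[OF insert.prems(1)]
    show ?case
    proof (cases "p u = \<zero>")
      case True
      then have "{w. p w \<noteq> \<zero>} \<subseteq> S" using insert.prems(2) by auto
      then show ?thesis using insert by blast
    next
      case False
      \<comment> \<open>\<open>I\<close> absorbs ring elements only, so the scalar
        \<open>p u\<close> enters as the constant polynomial \<open>k\<close>. The term at
        \<open>u\<close> is then \<open>k\<close> times the monomial, and \<open>r\<close> is what
        remains of \<open>p\<close>.\<close>
      define k where "k = (\<lambda>w :: 'x list. if w = [] then p u else \<zero>)"
      define r where "r = p(u := \<zero>)"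
      have k: "k \<in> carrier ?A" using c by (auto simp: k_def free_algebra_def)
      have m: "monomial R u \<in> I" using insert.prems(3) False by blast
      have t: "k \<otimes>\<^bsub>?A\<^esub> monomial R u \<in> I" using m k by (rule I.I_l_closed)
      have tu: "(k \<otimes>\<^bsub>?A\<^esub> monomial R u) u = p u"
      proof -
        have "(k \<otimes>\<^bsub>?A\<^esub> monomial R u) ([] @ u) = k [] \<otimes> monomial R u u"
          by (rule free_algebra_mult_unique_factorization[OF k I.a_Hcarr[OF m]])
            (auto simp: k_def split: if_splits)
        then show ?thesis using c by (simp add: k_def monomial_def)
      qed
      have tw: "(k \<otimes>\<^bsub>?A\<^esub> monomial R u) w = \<zero>" if "w \<noteq> u" for w
      proof (rule ccontr)
        assume "(k \<otimes>\<^bsub>?A\<^esub> monomial R u) w \<noteq> \<zero>"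
        then obtain x y where "w = x @ y" "k x \<noteq> \<zero>" "monomial R u y \<noteq> \<zero>"
          using free_algebra_mult_support[OF k I.a_Hcarr[OF m]] by metis
        with that show False by (auto simp: k_def monomial_def split: if_splits)
      qed
      have "{w. r w \<noteq> \<zero>} \<subseteq> {w. p w \<noteq> \<zero>}" by (auto simp: r_def)
      then have "finite {w. r w \<noteq> \<zero>}"
        using free_algebraD(3)[OF insert.prems(1)] by (rule finite_subset)
      then have "r \<in> carrier ?A"
        using insert.prems(1) by (auto simp: r_def free_algebra_def)
      moreover have "{w. r w \<noteq> \<zero>} \<subseteq> S" using insert.prems(2) by (auto simp: r_def)
      moreover have "monomial R w \<in> I" if "r w \<noteq> \<zero>" for w
        using that insert.prems(3)[of w] by (auto simp: r_def split: if_splits)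
      ultimately have "r \<in> I" by (rule insert.IH)
      moreover have "p w = (k \<otimes>\<^bsub>?A\<^esub> monomial R u) w \<oplus> r w" for w
        using c tu tw by (cases "w = u") (auto simp: r_def)
      then have "p = k \<otimes>\<^bsub>?A\<^esub> monomial R u \<oplus>\<^bsub>?A\<^esub> r"
        by (auto simp: free_algebra_def)
      ultimately show ?thesis using t by simp
    qed
  qed
  then show ?thesis using free_algebraD(3)[OF p] p supp by blast
qed

text \<open>The generators vanish on \<open>G\<close>, and the right-hand side is an ideal, so
  minimality gives one inclusion. Conversely, a polynomial vanishing on \<open>G\<close> is
  supported on words over \<open>V\<close> outside \<open>G\<close>, whose monomials are all
  generators.\<close>

lemma (in ring) genideal_monomials_eq:
  assumes G: "\<And>u v. G v \<Longrightarrow> sublist u v \<Longrightarrow> G u"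
  shows "Idl\<^bsub>free_algebra R V\<^esub> {monomial R u | u. u \<in> lists V \<and> \<not> G u}
    = {p \<in> carrier (free_algebra R V). \<forall>w. G w \<longrightarrow> p w = \<zero>}" (is "Idl\<^bsub>?A\<^esub> ?S = ?J")
proof
  interpret A: ring ?A by (rule free_algebra_ring)
  have SA: "?S \<subseteq> carrier ?A" by (auto intro: monomial_closed)
  have "?S \<subseteq> ?J" using SA by (auto simp: monomial_def)
  then show "Idl\<^bsub>?A\<^esub> ?S \<subseteq> ?J"
    using ideal_supported_outside_factor_closed[of G V] G by (intro A.genideal_minimal) auto
  show "?J \<subseteq> Idl\<^bsub>?A\<^esub> ?S"
  proof
    fix p assume p: "p \<in> ?J"
    show "p \<in> Idl\<^bsub>?A\<^esub> ?S"
    proof (rule mem_ideal_if_support_monomials[OF A.genideal_ideal[OF SA]])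
      show "p \<in> carrier ?A" using p by blast
    next
      fix w assume pw: "p w \<noteq> \<zero>"
      show "monomial R w \<in> Idl\<^bsub>?A\<^esub> ?S"
      proof (rule subsetD[OF A.genideal_self[OF SA]])
        have "w \<in> lists V" using free_algebraD(2)[of p R V w] p pw by auto
        moreover have "\<not> G w" using p pw by auto
        ultimately show "monomial R w \<in> ?S" by blast
      qed
    qed
  qed
qed

section \<open>Primeness of quotients by monomial ideals\<close>

lemma (in ring) longest_support_word:
  assumes "p \<in> carrier (free_algebra R V)" "G w" "p w \<noteq> \<zero>"
  obtains u where "G u" "p u \<noteq> \<zero>" "\<And>x. G x \<Longrightarrow> p x \<noteq> \<zero> \<Longrightarrow> length x \<le> length u"
proof -
  let ?S = "{w. p w \<noteq> \<zero> \<and> G w}"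
  have "finite ?S" by (rule finite_subset[OF _ free_algebraD(3)[OF assms(1)]]) auto
  then have fin: "finite (length ` ?S)" and ne: "length ` ?S \<noteq> {}" using assms by auto
  from Max_in[OF this] obtain u where "u \<in> ?S" "length u = Max (length ` ?S)" by auto
  then show ?thesis using that[of u] Max_ge[OF fin] by auto
qed

text \<open>\<open>u\<close> and \<open>v\<close> are longest only among support words in
  \<open>G\<close>. Longer support words outside \<open>G\<close> do no harm, since they cannot be
  factors of \<open>u @ w @ v\<close>. The one surviving product is nonzero because there are no
  zero divisors.\<close>

lemma (in domain) sandwich_nonzero_coefficient:
  assumes G: "\<And>u v. G v \<Longrightarrow> sublist u v \<Longrightarrow> G u"
    and p: "p \<in> carrier (free_algebra R V)" "p u \<noteq> \<zero>"
    and q: "q \<in> carrier (free_algebra R V)" "q v \<noteq> \<zero>"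
    and pmax: "\<And>x. G x \<Longrightarrow> p x \<noteq> \<zero> \<Longrightarrow> length x \<le> length u"
    and qmax: "\<And>x. G x \<Longrightarrow> q x \<noteq> \<zero> \<Longrightarrow> length x \<le> length v"
    and w: "w \<in> lists V" "G (u @ w @ v)"
  shows "(p \<otimes>\<^bsub>free_algebra R V\<^esub> monomial R w \<otimes>\<^bsub>free_algebra R V\<^esub> q) (u @ w @ v) \<noteq> \<zero>"
proof -
  let ?A = "free_algebra R V"
  interpret A: ring ?A by (rule free_algebra_ring)
  let ?r = "p \<otimes>\<^bsub>?A\<^esub> monomial R w"
  have m: "monomial R w \<in> carrier ?A" using w(1) by (rule monomial_closed)
  have r: "?r \<in> carrier ?A" using p m by simp
  have "?r (u @ w) = p u \<otimes> monomial R w w"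
    by (rule free_algebra_mult_unique_factorization[OF p(1) m])
      (auto simp: monomial_def split: if_splits)
  then have ru: "?r (u @ w) = p u" using free_algebraD(1)[OF p(1)] by (simp add: monomial_def)
  have "(?r \<otimes>\<^bsub>?A\<^esub> q) ((u @ w) @ v) = ?r (u @ w) \<otimes> q v"
  proof (rule free_algebra_mult_unique_factorization[OF r q(1)])
    fix z y assume zy: "z @ y = (u @ w) @ v" "?r z \<noteq> \<zero>" "q y \<noteq> \<zero>"
    then obtain x x' where "z = x @ x'" "p x \<noteq> \<zero>" "monomial R w x' \<noteq> \<zero>"
      using free_algebra_mult_support[OF p(1) m] by metis
    then have x: "z = x @ w" "p x \<noteq> \<zero>" by (auto simp: monomial_def split: if_splits)
    \<comment> \<open>Both sides contain the same \<open>w\<close>, so the lengths of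
      \<open>x\<close> and \<open>y\<close> add up to those of \<open>u\<close> and
      \<open>v\<close>. The two maximality bounds must then be equalities, and prefixes of equal
      length agree.\<close>
    have eq: "x @ w @ y = u @ w @ v" using zy(1) x by simp
    have "sublist x (x @ w @ y)" "sublist y ((x @ w) @ y)" by blast+
    then have "G x" "G y" using G w(2) eq by auto
    then have "length x \<le> length u" "length y \<le> length v" using pmax qmax x zy by auto
    moreover have "length x + length y = length u + length v"
      using arg_cong[OF eq, of length] by simp
    ultimately have "length x = length u" by linarith
    then show "z = u @ w" using eq x by simp
  qed
  then show ?thesis
    using ru p q free_algebraD(1)[OF p(1)] free_algebraD(1)[OF q(1)] by (simp add: integral_iff)
qed

text \<open>Reduces primeness, stated for ideals, to elements: nonzero ideals of the quotient
  contain cosets of some \<open>p\<close> and \<open>q\<close> outside \<open>K\<close>, and their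
  product contains the coset of \<open>p\<close>, \<open>m\<close>, \<open>q\<close> multiplied
  together, which is nonzero for a suitable \<open>m\<close>.\<close>

lemma prime_ring_Quot:
  assumes "ideal K A" "K \<noteq> carrier A"
    and sandwich: "\<And>p q. p \<in> carrier A - K \<Longrightarrow> q \<in> carrier A - K \<Longrightarrow>
      \<exists>m\<in>carrier A. p \<otimes>\<^bsub>A\<^esub> m \<otimes>\<^bsub>A\<^esub> q \<notin> K"
  shows "prime_ring (A Quot K)"
proof -
  interpret K: ideal K A by fact
  interpret Q: ring "A Quot K" by (rule K.quotient_is_ring)
  have coset: "\<exists>a\<in>carrier A. X = K +>\<^bsub>A\<^esub> a" if "X \<in> carrier (A Quot K)" for X
    using that by (auto simp: FactRing_def A_RCOSETS_def')
  have zero_iff: "K +>\<^bsub>A\<^esub> a = \<zero>\<^bsub>A Quot K\<^esub> \<longleftrightarrow> a \<in> K" if "a \<in> carrier A" for a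
    using that K.a_rcos_const K.rcos_const_imp_mem by (auto simp: FactRing_def)
  have mult: "(K +>\<^bsub>A\<^esub> a) \<otimes>\<^bsub>A Quot K\<^esub> (K +>\<^bsub>A\<^esub> b) = K +>\<^bsub>A\<^esub> (a \<otimes>\<^bsub>A\<^esub> b)"
    if "a \<in> carrier A" "b \<in> carrier A" for a b
    using that K.rcoset_mult_add by (simp add: FactRing_def)
  have mem: "K +>\<^bsub>A\<^esub> a \<in> carrier (A Quot K)" if "a \<in> carrier A" for a
    using that by (auto simp: FactRing_def A_RCOSETS_def')
  have nonzero_elem: "\<exists>a\<in>carrier A - K. K +>\<^bsub>A\<^esub> a \<in> X"
    if "ideal X (A Quot K)" "X \<noteq> {\<zero>\<^bsub>A Quot K\<^esub>}" for X
  proof -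
    interpret X: ideal X "A Quot K" by fact
    obtain x where "x \<in> X" "x \<noteq> \<zero>\<^bsub>A Quot K\<^esub>"
      using \<open>X \<noteq> _\<close> X.zero_closed by blast
    then show ?thesis using coset[OF X.a_Hcarr[of x]] zero_iff by blast
  qed
  show ?thesis
  proof unfold_locales
    obtain a where "a \<in> carrier A" "a \<notin> K" using assms(2) K.a_subset by blast
    then show "carrier (A Quot K) \<noteq> {\<zero>\<^bsub>A Quot K\<^esub>}"
      using mem[of a] zero_iff[of a] by auto
    fix X Y assume X: "ideal X (A Quot K)" and Y: "ideal Y (A Quot K)"
      and XY: "X \<cdot>\<^bsub>A Quot K\<^esub> Y = {\<zero>\<^bsub>A Quot K\<^esub>}"
    show "X = {\<zero>\<^bsub>A Quot K\<^esub>} \<or> Y = {\<zero>\<^bsub>A Quot K\<^esub>}"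
    proof (rule ccontr)
      assume "\<not> ?thesis"
      then obtain p q where p: "p \<in> carrier A - K" "K +>\<^bsub>A\<^esub> p \<in> X"
        and q: "q \<in> carrier A - K" "K +>\<^bsub>A\<^esub> q \<in> Y"
        using nonzero_elem X Y by meson
      obtain m where m: "m \<in> carrier A" "p \<otimes>\<^bsub>A\<^esub> m \<otimes>\<^bsub>A\<^esub> q \<notin> K"
        using sandwich[OF p(1) q(1)] by blast
      have "K +>\<^bsub>A\<^esub> (p \<otimes>\<^bsub>A\<^esub> m) \<in> X"
        using ideal.I_r_closed[OF X p(2) mem[OF m(1)]] mult[of p m] p m by simp
      then have "K +>\<^bsub>A\<^esub> (p \<otimes>\<^bsub>A\<^esub> m \<otimes>\<^bsub>A\<^esub> q) \<in> X \<cdot>\<^bsub>A Quot K\<^esub> Y"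
        using ideal_prod.prod[OF _ q(2), of _ X "A Quot K"] mult[of "p \<otimes>\<^bsub>A\<^esub> m" q] p m q by force
      then have "K +>\<^bsub>A\<^esub> (p \<otimes>\<^bsub>A\<^esub> m \<otimes>\<^bsub>A\<^esub> q) = \<zero>\<^bsub>A Quot K\<^esub>" using XY by simp
      with zero_iff[of "p \<otimes>\<^bsub>A\<^esub> m \<otimes>\<^bsub>A\<^esub> q"] p q m show False by simp
    qed
  qed
qed

lemma (in domain) prime_ring_monomial_algebra:
  assumes G: "\<And>u v. G v \<Longrightarrow> sublist u v \<Longrightarrow> G u"
    and "G []"
    and join: "\<And>u v. G u \<Longrightarrow> G v \<Longrightarrow> \<exists>w\<in>lists V. G (u @ w @ v)"
  shows "prime_ring (free_algebra R V Quot
    (Idl\<^bsub>free_algebra R V\<^esub> {monomial R u | u. u \<in> lists V \<and> \<not> G u}))"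
proof -
  let ?A = "free_algebra R V" and ?J = "{p \<in> carrier (free_algebra R V). \<forall>w. G w \<longrightarrow> p w = \<zero>}"
  have "prime_ring (?A Quot ?J)"
  proof (rule prime_ring_Quot)
    show "ideal ?J ?A" using G by (rule ideal_supported_outside_factor_closed)
    \<comment> \<open>The unit has coefficient 1 at the empty word, which lies in \<open>G\<close>;
      hence the ideal is proper.\<close>
    have "monomial R [] \<in> carrier ?A - ?J"
      using monomial_closed[of "[]" V] \<open>G []\<close> by (auto simp: monomial_def)
    then show "?J \<noteq> carrier ?A" by blast
    fix p q assume p: "p \<in> carrier ?A - ?J" and q: "q \<in> carrier ?A - ?J"
    obtain u where u: "G u" "p u \<noteq> \<zero>" "\<And>x. G x \<Longrightarrow> p x \<noteq> \<zero> \<Longrightarrow> length x \<le> length u"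
      using p longest_support_word[of p V G] by blast
    obtain v where v: "G v" "q v \<noteq> \<zero>" "\<And>x. G x \<Longrightarrow> q x \<noteq> \<zero> \<Longrightarrow> length x \<le> length v"
      using q longest_support_word[of q V G] by blast
    obtain w where w: "w \<in> lists V" "G (u @ w @ v)" using join u v by blast
    have "(p \<otimes>\<^bsub>?A\<^esub> monomial R w \<otimes>\<^bsub>?A\<^esub> q) (u @ w @ v) \<noteq> \<zero>"
      using sandwich_nonzero_coefficient[of G p V u q v w, OF G _ u(2) _ v(2) u(3) v(3) w] p q
      by simp
    then show "\<exists>m\<in>carrier ?A. p \<otimes>\<^bsub>?A\<^esub> m \<otimes>\<^bsub>?A\<^esub> q \<notin> ?J"
      using w monomial_closed[of w V] by (intro bexI[of _ "monomial R w"]) auto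
  qed
  then show ?thesis using genideal_monomials_eq[of G V] G by simp
qed

section \<open>Joining subwords of the words of \<open>W\<close>\<close>

theorem proposition2p4:
  fixes F :: "('a, 'm) ring_scheme"
    and f :: "nat \<Rightarrow> nat"
    and C d :: nat
    and Cset Wset :: "nat \<Rightarrow> nat list set"  \<comment> \<open>\<open>Cset n\<close> and \<open>Wset n\<close> are \<open>C(2 ^ n)\<close> and \<open>W(2 ^ n)\<close>\<close>
    and \<mu> :: "nat \<Rightarrow> nat"
  defines "A \<equiv> free_algebra F {1..d}"
    and "W \<equiv> \<Union>n. Wset n"
  defines "I \<equiv> Idl\<^bsub>A\<^esub> {monomial F u | u. u \<in> lists {1..d} \<and> \<not> (\<exists>w\<in>W. sublist u w)}"
  assumes "field F"
    and f_pos: "\<And>n. n \<ge> 1 \<Longrightarrow> f n \<ge> 1"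
    and f_increasing: "\<And>n. n \<ge> 1 \<Longrightarrow> f n < f (n + 1)"
    and f_submultiplicative: "\<And>m n. m \<ge> 1 \<Longrightarrow> n \<ge> 1 \<Longrightarrow> f (m + n) \<le> f m * f n"
    and "C > 0"
    and f_growth: "\<And>n. n \<ge> 1 \<Longrightarrow> f (C * n) \<ge> n * f n"
    and "d = f 1"
    and C_sub_W: "\<And>n. Cset n \<subseteq> Wset n"
    and W_sub_M: "\<And>n. Wset n \<subseteq> words d (2 ^ n)"
    and W_0: "Wset 0 = {[i] | i. i \<in> {1..d}}"
    and W_Suc: "\<And>n. Wset (n + 1) = Cset n \<bullet>\<^sub>w Wset n"
    and card_C: "\<And>n. int (card (Cset n)) = \<lceil>real (f (2 ^ (n + 1))) / real (f (2 ^ n))\<rceil>"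
    and \<mu>_pos: "\<And>n. \<mu> n \<ge> 1"
    and \<mu>_increasing: "\<And>n. \<mu> n < \<mu> (n + 1)"
    and \<mu>_large: "\<And>n. f (2 ^ (\<mu> n + 1)) \<ge> card (Wset n) * f (2 ^ \<mu> n)"
    and proj: "\<And>n. n \<ge> 1 \<Longrightarrow> suffix_proj (\<mu> n) n ` Cset (\<mu> n) = Wset n"
  shows "prime_ring (A Quot I)"
proof -
  interpret F: field F by (rule \<open>field F\<close>)
  \<comment> \<open>The ceiling of a positive quotient is positive. Nonemptiness lets every word be
    extended to the next level and makes \<open>W\<close> nonempty.\<close>
  have C_nonempty: "Cset n \<noteq> {}" for n
  proof -
    have "real (f (2 ^ (n + 1))) / real (f (2 ^ n)) > 0"
      using f_pos[of "2 ^ (n + 1)"] f_pos[of "2 ^ n"] by simp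
    then have "card (Cset n) \<noteq> 0"
      using card_C[of n] by linarith
    then show ?thesis by auto
  qed
  \<comment> \<open>Any \<open>c\<close> in \<open>Cset n\<close> can be put in front of
    \<open>w\<close>, which becomes a suffix of a word one level up.\<close>
  have W_step: "\<exists>w'\<in>Wset (n + 1). sublist w w'" if "w \<in> Wset n" for n w
    using that C_nonempty[of n] unfolding W_Suc word_prod_def by blast
  have W_mono: "\<exists>w'\<in>Wset (n + k). sublist w w'" if "w \<in> Wset n" for n k w
  proof (induction k)
    case (Suc k)
    then show ?case using W_step[of _ "n + k"] sublist_order.order_trans by fastforce
  qed (use that in auto)
  let ?G = "\<lambda>u. \<exists>w\<in>W. sublist u w"
  show ?thesis
    unfolding I_def A_def
  proof (rule F.prime_ring_monomial_algebra)
    show "?G u" if "?G v" "sublist u v" for u v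
      using that sublist_order.order_trans by blast
    show "?G []"
      using C_nonempty[of 0] C_sub_W[of 0] unfolding W_def by blast
    fix u v assume "?G u" "?G v"
    then obtain m n s t where st: "s \<in> Wset m" "sublist u s" "t \<in> Wset n" "sublist v t"
      unfolding W_def by blast
    \<comment> \<open>A common level above both \<open>m\<close> and \<open>n\<close>; the summand 1
      ensures that \<open>k\<close> is at least 1, as \<open>proj\<close> requires.\<close>
    define k where "k = m + n + 1"
    obtain s' where s': "s' \<in> Wset k" "sublist s s'"
      using W_mono[OF st(1), of "n + 1"] by (auto simp: k_def)
    obtain t' where t': "t' \<in> Wset k" "sublist t t'"
      using W_mono[OF st(3), of "m + 1"] by (auto simp: k_def ac_simps)
    \<comment> \<open>Only surjectivity of the projection is used: \<open>x\<close> is what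
      \<open>drop\<close> leaves of some \<open>c\<close>, and \<open>b\<close> is the prefix cut
      off.\<close>
    have suffix: "\<exists>c b. c \<in> Cset (\<mu> k) \<and> c = b @ x" if "x \<in> Wset k" for x
      using that proj[of k] unfolding suffix_proj_def k_def by (metis append_take_drop_id imageE le_add2)
    obtain c b where c: "c \<in> Cset (\<mu> k)" "c = b @ s'" using suffix[OF s'(1)] by blast
    obtain c' b' where c': "c' \<in> Cset (\<mu> k)" "c' = b' @ t'" using suffix[OF t'(1)] by blast
    \<comment> \<open>The second factor is admissible because \<open>Cset\<close> at level
      \<open>\<mu> k\<close> is contained in \<open>Wset\<close> at that level.\<close>
    have cc': "c @ c' \<in> Wset (\<mu> k + 1)"
      using c(1) c'(1) C_sub_W unfolding W_Suc word_prod_def by blast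
    obtain x y where x: "s' = x @ u @ y"
      using st(2) s'(2) sublist_order.order_trans[of u s s'] by (auto simp: sublist_def)
    obtain x' y' where x': "t' = x' @ v @ y'"
      using st(4) t'(2) sublist_order.order_trans[of v t t'] by (auto simp: sublist_def)
    \<comment> \<open>The joining word is the rest \<open>y\<close> of \<open>c\<close> after
      \<open>u\<close>, followed by the part \<open>b' @ x'\<close> of \<open>c'\<close> before
      \<open>v\<close>. Its letters are in range because those of \<open>c @ c'\<close> are.\<close>
    have eq: "c @ c' = (b @ x) @ (u @ (y @ b' @ x') @ v) @ y'"
      using c c' x x' by simp
    have "c @ c' \<in> lists {1..d}"
      using cc' W_sub_M by (force simp: words_def)
    then have "y @ b' @ x' \<in> lists {1..d}" unfolding eq by simp
    moreover have "?G (u @ (y @ b' @ x') @ v)"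
      using cc' eq unfolding W_def by (metis UNIV_I UN_I sublist_appendI)
    ultimately show "\<exists>w\<in>lists {1..d}. ?G (u @ w @ v)" by blast
  qed
qed

end
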